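(* Let $(\boldsymbol\varphi,\boldsymbol p,\mathbf R,\boldsymbol\sigma)(S,t)$ be a smooth solution of the equations of motion $$\frac{\partial\boldsymbol\varphi}{\partial t}=\mathbb A^{-1}\boldsymbol p,\quad \frac{\partial\boldsymbol p}{\partial t}=\frac{\partial(\mathbb G\boldsymbol\varepsilon)}{\partial S},\quad \frac{\partial\mathbf R}{\partial t}=\mathbf R\,j^{-1}(\mathbb J^{-1}\boldsymbol\sigma),\quad \frac{\partial\boldsymbol\sigma}{\partial t}=\frac{\partial(\mathbb H\boldsymbol\kappa)}{\partial S}+\frac{\partial\boldsymbol\varphi}{\partial S}\wedge(\mathbb G\boldsymbol\varepsilon).$$ Then for any test function $f:(\mathbb R^3)^{[0,L]}\to\mathbb R$, $$\frac{\partial}{\partial t}f(\boldsymbol\varepsilon(t))=\int_0^L\Big\langle\frac{\partial f}{\partial\boldsymbol\varepsilon},\frac{\partial\boldsymbol v}{\partial S}-\boldsymbol\omega\wedge\boldsymbol d_3\Big\rangle dS,$$ where $\boldsymbol v=\mathbb A^{-1}\boldsymbol p$ and $\boldsymbol\omega=\mathbb J^{-1}\boldsymbol\sigma$.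
   Context: $S\in[0,L]$; $\boldsymbol\varphi,\boldsymbol p,\boldsymbol\sigma$ are $\mathbb R^3$-valued and $\mathbf R$ is $SO(3)$-valued. $\langle\cdot,\cdot\rangle$ is the Euclidean scalar product of $\mathbb R^3$ and $\wedge$ the cross product. $(\boldsymbol e_1,\boldsymbol e_2,\boldsymbol e_3)$ is a fixed positively oriented orthonormal basis, identified with the canonical basis of $\mathbb R^3$; the moving frame is $\boldsymbol d_i=\mathbf R\boldsymbol e_i$. A bold vector $\boldsymbol u=u_i\boldsymbol d_i$ is a vector of the ambient $\mathbb R^3$ with moving-frame components $u=\mathbf R^{-1}\boldsymbol u$; derivatives of bold vectors are those of $\mathbb R^3$-valued functions (the frame is differentiated too). The map $j:so(3)\to\mathbb R^3$ sends a skew matrix $A$ to the column $a$ with $Ax=a\wedge x$ for all $x$; with bold vectors, $j^{-1}(\boldsymbol u)$ means the skew matrix $j^{-1}(u)$ built on the moving components. The curvature $\boldsymbol\kappa$ is the bold vector with moving components $j(\mathbf R^{-1}\partial_S\mathbf R)$ and the strain-vector is $\boldsymbol\varepsilon=\partial_S\boldsymbol\varphi-\boldsymbol d_3$. The tensors are diagonal with constant positive entries in the moving frame: $\mathbb G=\mathrm{diag}(GA,GA,EA)$, $\mathbb H=\mathrm{diag}(EI_1,EI_2,GI_3)$, $\mathbb A=\rho A\,\mathrm{Id}$, $\mathbb J=\rho\,\mathrm{diag}(I_1,I_2,I_3)$; $\mathbb X\boldsymbol u$ is the bold vector with moving components $\mathbb Xu$. A test function $f$ is a differentiable functional of an $\mathbb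 R^3$-valued field on $[0,L]$, with gradient $\partial f/\partial\boldsymbol\varepsilon$ defined by $df(\boldsymbol\varepsilon)\cdot\delta\boldsymbol\varepsilon=\int_0^L\langle\partial f/\partial\boldsymbol\varepsilon,\delta\boldsymbol\varepsilon\rangle dS$. *)

theory Defs
  imports "HOL-Analysis.Analysis"
begin

section \<open>Smooth maps on domains with boundary\<close>

text \<open>
  \<open>C_k_on n D f\<close>: \<open>f\<close> is n times continuously differentiable on \<open>D\<close>, up to the boundary.
  It is meant for domains such as \<open>[0,L]\<close> or \<open>[0,L] \<times> T\<close> with nonempty interior and convex,
  where derivatives within \<open>D\<close> are unique.
\<close>

primrec C_k_on ::
    "nat \<Rightarrow> 'a::euclidean_space set \<Rightarrow> ('a \<Rightarrow> 'b::real_normed_vector) \<Rightarrow> bool" where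
  "C_k_on 0 D f \<longleftrightarrow> continuous_on D f"
| "C_k_on (Suc n) D f \<longleftrightarrow>
     (\<exists>f'. (\<forall>x\<in>D. (f has_derivative f' x) (at x within D)) \<and> (\<forall>h. C_k_on n D (\<lambda>x. f' x h)))"

definition smooth_on_dom ::
    "'a::euclidean_space set \<Rightarrow> ('a \<Rightarrow> 'b::real_normed_vector) \<Rightarrow> bool" where
  "smooth_on_dom D f \<longleftrightarrow> (\<forall>n. C_k_on n D f)"

definition deriv_seg :: "real \<Rightarrow> (real \<Rightarrow> 'b::real_normed_vector) \<Rightarrow> real \<Rightarrow> 'b" where
  "deriv_seg L u S = vector_derivative u (at S within {0..L})"

abbreviation partial_S ::
    "real \<Rightarrow> (real \<Rightarrow> real \<Rightarrow> 'b::real_normed_vector) \<Rightarrow> real \<Rightarrow> real \<Rightarrow> 'b" where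
  "partial_S L u S t \<equiv> deriv_seg L (\<lambda>s. u s t) S"


section \<open>Skew matrices and the moving frame\<close>

text \<open>\<open>j_map\<close> is only meaningful on skew matrices; \<open>j_inv\<close> is its inverse.\<close>

definition j_map :: "real^3^3 \<Rightarrow> real^3" where
  "j_map M = (THE a. \<forall>x. M *v x = cross3 a x)"

definition j_inv :: "real^3 \<Rightarrow> real^3^3" where
  "j_inv a = matrix (cross3 a)"

lemma j_inv_mult: "j_inv a *v x = cross3 a x"
proof -
  have "linear (cross3 a)"
    by (simp add: bounded_linear.linear cross_add_right cross_mult_right linearI)
  then show ?thesis
    unfolding j_inv_def by (simp add: matrix_works)
qed

lemma j_map_j_inv: "j_map (j_inv a) = a"
  unfolding j_map_def
proof (rule the_equality)
  show "\<forall>x. j_inv a *v x = cross3 a x" by (simp add: j_inv_mult)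
next
  fix b assume "\<forall>x. j_inv a *v x = cross3 b x"
  then have *: "cross3 a x = cross3 b x" for x by (simp add: j_inv_mult)
  show "b = a"
    using *[of "axis 1 1"] *[of "axis 2 1"]
    by (simp add: cross3_simps axis_def vec_eq_iff forall_3)
qed

lemma j_inv_j_map:
  assumes "transpose M = - M"
  shows "j_inv (j_map M) = M"
proof -
  have sk: "M $ i $ k = - M $ k $ i" for i k
  proof -
    have "transpose M $ k $ i = - M $ k $ i" using assms by simp
    then show ?thesis by (simp add: transpose_def)
  qed
  let ?a = "vector [M$3$2, M$1$3, M$2$1] :: real^3"
  have d: "M$1$1 = 0" "M$2$2 = 0" "M$3$3 = 0" "M$1$2 = - M$2$1" "M$2$3 = - M$3$2" "M$3$1 = - M$1$3"
    using sk[of 1 1] sk[of 2 2] sk[of 3 3] sk[of 1 2] sk[of 2 3] sk[of 3 1] by auto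
  have "M *v x = j_inv ?a *v x" for x
    unfolding j_inv_mult
    by (simp add: vec_eq_iff forall_3 matrix_vector_mult_def sum_3 cross3_def d)
  then have "M = j_inv ?a" by (simp add: matrix_eq)
  then show ?thesis by (metis j_map_j_inv)
qed

text \<open>
  All vector fields below are stored as vectors of the ambient space.  For a frame \<open>Q\<close>,
  \<open>frame_comps Q u\<close> are the moving-frame components of \<open>u\<close>, and \<open>in_frame Q X\<close> is the tensor
  whose matrix in the frame \<open>Q\<close> is \<open>X\<close>.
\<close>

definition frame_comps :: "real^3^3 \<Rightarrow> real^3 \<Rightarrow> real^3" where
  "frame_comps Q u = matrix_inv Q *v u"

definition in_frame :: "real^3^3 \<Rightarrow> real^3^3 \<Rightarrow> real^3 \<Rightarrow> real^3" where
  "in_frame Q X u = Q *v (X *v frame_comps Q u)"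

definition director :: "real^3^3 \<Rightarrow> 3 \<Rightarrow> real^3" where
  "director Q i = Q *v axis i 1"

definition curvature :: "real \<Rightarrow> (real \<Rightarrow> real \<Rightarrow> real^3^3) \<Rightarrow> real \<Rightarrow> real \<Rightarrow> real^3" where
  "curvature L R S t = R S t *v j_map (matrix_inv (R S t) ** partial_S L R S t)"

definition strain ::
    "real \<Rightarrow> (real \<Rightarrow> real \<Rightarrow> real^3) \<Rightarrow> (real \<Rightarrow> real \<Rightarrow> real^3^3) \<Rightarrow> real \<Rightarrow> real \<Rightarrow> real^3" where
  "strain L \<phi> R S t = partial_S L \<phi> S t - director (R S t) 3"

definition diag3 :: "real \<Rightarrow> real \<Rightarrow> real \<Rightarrow> real^3^3" where
  "diag3 a b c = (\<chi> i k. if i = k then vector [a, b, c] $ i else 0)"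

definition G_tensor :: "real \<Rightarrow> real \<Rightarrow> real \<Rightarrow> real^3^3" where
  "G_tensor E G A = diag3 (G * A) (G * A) (E * A)"

definition H_tensor :: "real \<Rightarrow> real \<Rightarrow> real \<Rightarrow> real \<Rightarrow> real \<Rightarrow> real^3^3" where
  "H_tensor E G I1 I2 I3 = diag3 (E * I1) (E * I2) (G * I3)"

definition A_tensor :: "real \<Rightarrow> real \<Rightarrow> real^3^3" where
  "A_tensor \<rho> A = mat (\<rho> * A)"

definition J_tensor :: "real \<Rightarrow> real \<Rightarrow> real \<Rightarrow> real \<Rightarrow> real^3^3" where
  "J_tensor \<rho> I1 I2 I3 = diag3 (\<rho> * I1) (\<rho> * I2) (\<rho> * I3)"


section \<open>Differentiable functionals of a field on \<open>[0,L]\<close>\<close>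

text \<open>
  A field on \<open>[0,L]\<close> is represented by its extensional version, so that a functional sees
  nothing outside \<open>[0,L]\<close>.
\<close>

definition field_of :: "real \<Rightarrow> (real \<Rightarrow> real^3) \<Rightarrow> (real \<Rightarrow> real^3)" where
  "field_of L u = restrict u {0..L}"

definition smooth_fields :: "real \<Rightarrow> (real \<Rightarrow> real^3) set" where
  "smooth_fields L = {u \<in> extensional {0..L}. smooth_on_dom {0..L} u}"

definition C_k_norm :: "nat \<Rightarrow> real \<Rightarrow> (real \<Rightarrow> real^3) \<Rightarrow> real" where
  "C_k_norm k L h = (\<Sum>i\<le>k. SUP S\<in>{0..L}. norm ((deriv_seg L ^^ i) h S))"

text \<open>
  Frechet differentiability at the smooth field \<open>u\<close>, tested on smooth variations and with respect
  to the \<open>C\<^sup>k\<close> norm.  The case \<open>k = 0\<close> is the sup norm; larger \<open>k\<close> admit functionals that involve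
  derivatives of the field.
\<close>

definition has_differential ::
    "nat \<Rightarrow> real \<Rightarrow> ((real \<Rightarrow> real^3) \<Rightarrow> real) \<Rightarrow> (real \<Rightarrow> real^3) \<Rightarrow> ((real \<Rightarrow> real^3) \<Rightarrow> real) \<Rightarrow> bool" where
  "has_differential k L f u df \<longleftrightarrow>
     (\<forall>h1\<in>smooth_fields L. \<forall>h2\<in>smooth_fields L. \<forall>a b.
        df (field_of L (\<lambda>S. a *\<^sub>R h1 S + b *\<^sub>R h2 S)) = a * df h1 + b * df h2) \<and>
     (\<exists>B. \<forall>h\<in>smooth_fields L. \<bar>df h\<bar> \<le> B * C_k_norm k L h) \<and>
     (\<forall>e>0. \<exists>d>0. \<forall>h\<in>smooth_fields L. C_k_norm k L h < d \<longrightarrow>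
        \<bar>f (field_of L (\<lambda>S. u S + h S)) - f u - df h\<bar> \<le> e * C_k_norm k L h)"

definition has_gradient ::
    "nat \<Rightarrow> real \<Rightarrow> ((real \<Rightarrow> real^3) \<Rightarrow> real) \<Rightarrow> (real \<Rightarrow> real^3) \<Rightarrow> (real \<Rightarrow> real^3) \<Rightarrow> bool" where
  "has_gradient k L f u g \<longleftrightarrow>
     (\<exists>df. has_differential k L f u df \<and>
        (\<forall>h\<in>smooth_fields L. ((\<lambda>S. g S \<bullet> h S) has_integral df h) {0..L}))"

definition test_function ::
    "nat \<Rightarrow> real \<Rightarrow> ((real \<Rightarrow> real^3) \<Rightarrow> real) \<Rightarrow> ((real \<Rightarrow> real^3) \<Rightarrow> (real \<Rightarrow> real^3)) \<Rightarrow> bool" where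
  "test_function k L f grad \<longleftrightarrow> (\<forall>u\<in>smooth_fields L. has_gradient k L f u (grad u))"

end

theory Submission
  imports Defs
begin

text \<open>
  The strain is a smooth field on \<open>[0,L] \<times> T\<close> up to the boundary, so on the compact segment \<open>[0,L]\<close> its
  difference quotients in time converge to \<open>\<partial>\<^sub>t \<epsilon>\<close> uniformly together with all \<open>S\<close>-derivatives, i.e. in
  every \<open>C\<^sup>k\<close> norm; hence the Frechet differential of \<open>f\<close> gives the chain rule.  It remains to compute
  \<open>\<partial>\<^sub>t \<epsilon>\<close>: mixed partial derivatives commute, which yields \<open>\<partial>\<^sub>S v\<close>, and \<open>\<partial>\<^sub>t d\<^sub>3 = R (w \<times> e\<^sub>3) = \<omega> \<times> d\<^sub>3\<close>
  with \<open>w = R\<^sup>-\<^sup>1 \<omega>\<close>, because rotations preserve the cross product.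
\<close>

section \<open>Closure properties of smooth maps on a domain\<close>

text \<open>Derivatives are taken within \<open>D\<close>, so values off \<open>D\<close> never
  enter. The same family \<open>f'\<close> differentiates both maps, hence a case distinction on
  \<open>n\<close> suffices.\<close>

lemma C_k_on_cong:
  assumes "\<And>x. x \<in> D \<Longrightarrow> f x = g x" "C_k_on n D f"
  shows "C_k_on n D g"
proof (cases n)
  case 0
  then show ?thesis using assms continuous_on_cong by force
next
  case (Suc m)
  with assms obtain f' where f': "\<forall>x\<in>D. (f has_derivative f' x) (at x within D)"
    "\<forall>h. C_k_on m D (\<lambda>x. f' x h)" by auto
  have "\<forall>x\<in>D. (g has_derivative f' x) (at x within D)"
    using f' assms(1) by (metis has_derivative_transform)
  with f' Suc show ?thesis by auto
qed

lemma smooth_on_dom_cong: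
  "(\<And>x. x \<in> D \<Longrightarrow> f x = g x) \<Longrightarrow> smooth_on_dom D f \<Longrightarrow> smooth_on_dom D g"
  unfolding smooth_on_dom_def by (blast intro: C_k_on_cong)

text \<open>A bounded linear \<open>l\<close> commutes with differentiation: composing the
  derivative family of \<open>f\<close> with \<open>l\<close> gives one for the composite, to which
  the induction hypothesis applies.\<close>

lemma C_k_on_bounded_linear:
  assumes "bounded_linear l" "C_k_on n D f"
  shows "C_k_on n D (\<lambda>x. l (f x))"
  using assms(2)
proof (induction n arbitrary: f)
  case 0
  then show ?case using bounded_linear.continuous_on[OF assms(1)] by simp
next
  case (Suc n)
  then obtain f' where "\<forall>x\<in>D. (f has_derivative f' x) (at x within D)"
    "\<forall>h. C_k_on n D (\<lambda>x. f' x h)" by auto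
  then have "\<forall>x\<in>D. ((\<lambda>x. l (f x)) has_derivative (\<lambda>h. l (f' x h))) (at x within D)"
    "\<forall>h. C_k_on n D (\<lambda>x. l (f' x h))"
    using Suc.IH bounded_linear.has_derivative[OF assms(1)] by blast+
  then show ?case unfolding C_k_on.simps by (intro exI conjI)
qed

lemma smooth_on_dom_bounded_linear:
  "bounded_linear l \<Longrightarrow> smooth_on_dom D f \<Longrightarrow> smooth_on_dom D (\<lambda>x. l (f x))"
  unfolding smooth_on_dom_def by (blast intro: C_k_on_bounded_linear)

lemma C_k_on_add:
  assumes "C_k_on n D f" "C_k_on n D g"
  shows "C_k_on n D (\<lambda>x. f x + g x)"
  using assms
proof (induction n arbitrary: f g)
  case 0
  then show ?case by (auto intro: continuous_on_add)
next
  case (Suc n)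
  obtain f' where f': "\<forall>x\<in>D. (f has_derivative f' x) (at x within D)"
    "\<forall>h. C_k_on n D (\<lambda>x. f' x h)" using Suc.prems by auto
  obtain g' where g': "\<forall>x\<in>D. (g has_derivative g' x) (at x within D)"
    "\<forall>h. C_k_on n D (\<lambda>x. g' x h)" using Suc.prems by auto
  have "\<forall>x\<in>D. ((\<lambda>x. f x + g x) has_derivative (\<lambda>h. f' x h + g' x h)) (at x within D)"
    "\<forall>h. C_k_on n D (\<lambda>x. f' x h + g' x h)"
    using f' g' Suc.IH has_derivative_add by blast+
  then show ?case unfolding C_k_on.simps by (intro exI conjI)
qed

lemma smooth_on_dom_lincomb:
  assumes "smooth_on_dom D f" "smooth_on_dom D g"
  shows "smooth_on_dom D (\<lambda>x. a *\<^sub>R f x + b *\<^sub>R g x)"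
  unfolding smooth_on_dom_def
proof
  fix n
  have "C_k_on n D f" "C_k_on n D g" using assms by (simp_all add: smooth_on_dom_def)
  then show "C_k_on n D (\<lambda>x. a *\<^sub>R f x + b *\<^sub>R g x)"
    by (intro C_k_on_add C_k_on_bounded_linear[OF bounded_linear_scaleR_right])
qed

lemma smooth_on_dom_diff:
  assumes "smooth_on_dom D f" "smooth_on_dom D g"
  shows "smooth_on_dom D (\<lambda>x. f x - g x)"
  using smooth_on_dom_lincomb[OF assms, of 1 "-1"] by simp

lemma smooth_on_dom_continuous: "smooth_on_dom D f \<Longrightarrow> continuous_on D f"
  using C_k_on.simps(1)[of D f] unfolding smooth_on_dom_def by blast

section \<open>Derivatives up to the boundary on intervals\<close>

lemma has_derivative_imp_has_vector_derivative:
  assumes "(u has_derivative u') (at s within X)"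
  shows "(u has_vector_derivative u' 1) (at s within X)"
proof -
  have "u' h = h *\<^sub>R u' 1" for h
    using linear_scale[OF has_derivative_linear[OF assms], of h 1] by simp
  then have "u' = (\<lambda>h. h *\<^sub>R u' 1)" by (rule ext)
  with assms show ?thesis by (metis has_vector_derivative_def)
qed

text \<open>A connected set with more than one point has no isolated points. This makes time
  derivatives within \<open>T\<close> unique, also at endpoints of \<open>T\<close>.\<close>

lemma at_within_interval_ne_bot:
  fixes T :: "real set"
  assumes "is_interval T" "interior T \<noteq> {}" "t \<in> T"
  shows "at t within T \<noteq> bot"
proof -
  have "T \<noteq> {x}" for x using assms(2) by auto
  then have "t islimpt T"
    using assms by (metis connected_imp_perfect is_interval_connected)
  then show ?thesis by (simp add: trivial_limit_within)
qed

lemma deriv_seg_eq: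
  assumes "0 < L" "S \<in> {0..L}" "(u has_vector_derivative u') (at S within {0..L})"
  shows "deriv_seg L u S = u'"
  using assms unfolding deriv_seg_def
  by (intro vector_derivative_within) (auto simp: trivial_limit_within)

lemma deriv_seg_cong:
  assumes "\<And>s. s \<in> {0..L} \<Longrightarrow> u s = w s" "S \<in> {0..L}"
  shows "deriv_seg L u S = deriv_seg L w S"
proof -
  have "(u has_vector_derivative d) (at S within {0..L}) \<longleftrightarrow>
        (w has_vector_derivative d) (at S within {0..L})" for d
    using assms by (metis has_vector_derivative_transform)
  then show ?thesis by (simp add: deriv_seg_def vector_derivative_def)
qed

text \<open>One-sided derivatives at the ends look only inside the segment. This allows a field and
  its extensional version to be exchanged inside \<open>C_k_norm\<close>.\<close>

lemma deriv_seg_iterate_cong: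
  assumes "\<And>s. s \<in> {0..L} \<Longrightarrow> u s = w s" "S \<in> {0..L}"
  shows "(deriv_seg L ^^ i) u S = (deriv_seg L ^^ i) w S"
  using assms(2)
proof (induction i arbitrary: S)
  case 0
  then show ?case using assms(1) by simp
next
  case (Suc i)
  then show ?case by (auto intro: deriv_seg_cong)
qed

text \<open>The derivative family hidden in \<open>C_k_on\<close> depends on the order, but its
  value at the direction \<open>1\<close> must equal \<open>deriv_seg L u\<close> by uniqueness.
  Hence one and the same function is of class \<open>C_k_on n\<close> for every
  \<open>n\<close>.\<close>

lemma smooth_on_dom_seg:
  assumes "0 < L" "smooth_on_dom {0..L} u"
  shows "smooth_on_dom {0..L} (deriv_seg L u)"
    and "\<And>S. S \<in> {0..L} \<Longrightarrow> (u has_vector_derivative deriv_seg L u S) (at S within {0..L})"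
proof -
  have "C_k_on n {0..L} (deriv_seg L u) \<and>
    (\<forall>S\<in>{0..L}. (u has_vector_derivative deriv_seg L u S) (at S within {0..L}))" for n
  proof -
    have "C_k_on (Suc n) {0..L} u" using assms(2) by (simp add: smooth_on_dom_def del: C_k_on.simps)
    then obtain u' where u': "\<forall>S\<in>{0..L}. (u has_derivative u' S) (at S within {0..L})"
      "\<forall>h. C_k_on n {0..L} (\<lambda>S. u' S h)" by auto
    have d: "(u has_vector_derivative u' S 1) (at S within {0..L})" if "S \<in> {0..L}" for S
      using u'(1) that by (auto intro: has_derivative_imp_has_vector_derivative)
    have "C_k_on n {0..L} (deriv_seg L u)"
      using u'(2) by (rule_tac C_k_on_cong[of _ "\<lambda>S. u' S 1"]) (auto simp: deriv_seg_eq[OF assms(1) _ d])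
    moreover have "(u has_vector_derivative deriv_seg L u S) (at S within {0..L})" if "S \<in> {0..L}" for S
      using d deriv_seg_eq[OF assms(1) that d] that by simp
    ultimately show ?thesis by blast
  qed
  then show "smooth_on_dom {0..L} (deriv_seg L u)"
    "\<And>S. S \<in> {0..L} \<Longrightarrow> (u has_vector_derivative deriv_seg L u S) (at S within {0..L})"
    unfolding smooth_on_dom_def by blast+
qed

lemma smooth_on_dom_deriv_seg_iterate:
  assumes "0 < L" "smooth_on_dom {0..L} u"
  shows "smooth_on_dom {0..L} ((deriv_seg L ^^ i) u)"
  using assms by (induction i) (auto intro: smooth_on_dom_seg)

text \<open>\<open>vector_derivative\<close> is total and behaves linearly where derivatives exist;
  smoothness supplies these derivatives at every order.\<close>

lemma deriv_seg_iterate_lincomb: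
  assumes "0 < L" "smooth_on_dom {0..L} u" "smooth_on_dom {0..L} w" "S \<in> {0..L}"
  shows "(deriv_seg L ^^ i) (\<lambda>s. a *\<^sub>R u s + b *\<^sub>R w s) S =
         a *\<^sub>R (deriv_seg L ^^ i) u S + b *\<^sub>R (deriv_seg L ^^ i) w S"
  using assms(4)
proof (induction i arbitrary: S)
  case 0
  then show ?case by simp
next
  case (Suc i)
  have "(deriv_seg L ^^ Suc i) (\<lambda>s. a *\<^sub>R u s + b *\<^sub>R w s) S =
        deriv_seg L (\<lambda>s. a *\<^sub>R (deriv_seg L ^^ i) u s + b *\<^sub>R (deriv_seg L ^^ i) w s) S"
    using Suc by (auto intro: deriv_seg_cong)
  also have "\<dots> = a *\<^sub>R (deriv_seg L ^^ Suc i) u S + b *\<^sub>R (deriv_seg L ^^ Suc i) w S"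
  proof (rule deriv_seg_eq[OF assms(1) Suc.prems])
    note sm = smooth_on_dom_deriv_seg_iterate[OF assms(1), of _ i]
    note d = smooth_on_dom_seg(2)[OF assms(1) sm Suc.prems]
    show "((\<lambda>s. a *\<^sub>R (deriv_seg L ^^ i) u s + b *\<^sub>R (deriv_seg L ^^ i) w s) has_vector_derivative
      a *\<^sub>R (deriv_seg L ^^ Suc i) u S + b *\<^sub>R (deriv_seg L ^^ Suc i) w S) (at S within {0..L})"
      using d[OF assms(2)] d[OF assms(3)]
      by (intro has_vector_derivative_add)
        (auto intro!: bounded_linear.has_vector_derivative[OF bounded_linear_scaleR_right])
  qed
  finally show ?case .
qed

text \<open>The common bound \<open>c\<close> keeps each set of values bounded above, so that every
  \<open>SUP\<close> is a genuine supremum; it dominates the nonnegative value at \<open>0\<close>.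
  The factor \<open>Suc k\<close> counts the orders from \<open>0\<close> to
  \<open>k\<close>.\<close>

lemma C_k_norm_bounds:
  assumes "0 \<le> L" "\<And>i S. i \<le> k \<Longrightarrow> S \<in> {0..L} \<Longrightarrow> norm ((deriv_seg L ^^ i) h S) \<le> c"
  shows "0 \<le> C_k_norm k L h" "C_k_norm k L h \<le> real (Suc k) * c"
proof -
  have "0 \<le> (SUP S\<in>{0..L}. norm ((deriv_seg L ^^ i) h S)) \<and>
        (SUP S\<in>{0..L}. norm ((deriv_seg L ^^ i) h S)) \<le> c" if "i \<le> k" for i
  proof
    show "0 \<le> (SUP S\<in>{0..L}. norm ((deriv_seg L ^^ i) h S))"
      using assms that
      by (intro cSUP_upper2[where x=0]) (auto intro!: bdd_aboveI2[where M=c])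
    show "(SUP S\<in>{0..L}. norm ((deriv_seg L ^^ i) h S)) \<le> c"
      using assms that by (intro cSUP_least) auto
  qed
  then have b: "\<And>i. i \<in> {..k} \<Longrightarrow> 0 \<le> (SUP S\<in>{0..L}. norm ((deriv_seg L ^^ i) h S))"
    "\<And>i. i \<in> {..k} \<Longrightarrow> (SUP S\<in>{0..L}. norm ((deriv_seg L ^^ i) h S)) \<le> c" by auto
  show "0 \<le> C_k_norm k L h"
    unfolding C_k_norm_def by (rule sum_nonneg) (rule b)
  show "C_k_norm k L h \<le> real (Suc k) * c"
    using sum_bounded_above[of "{..k}", OF b(2)] by (simp add: C_k_norm_def)
qed

section \<open>Partial derivatives on the product domain and their commutation\<close>

text \<open>Stated for maps of a pair, the form in which \<open>smooth_on_dom\<close> expresses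
  joint smoothness in space and time, and iterable with \<open>^^\<close>.\<close>

definition partial_fst :: "real \<Rightarrow> (real \<times> real \<Rightarrow> 'b::real_normed_vector) \<Rightarrow> real \<times> real \<Rightarrow> 'b" where
  "partial_fst L F = (\<lambda>(S, t). deriv_seg L (\<lambda>s. F (s, t)) S)"

definition partial_snd :: "real set \<Rightarrow> (real \<times> real \<Rightarrow> 'b::real_normed_vector) \<Rightarrow> real \<times> real \<Rightarrow> 'b" where
  "partial_snd T F = (\<lambda>(S, t). vector_derivative (\<lambda>\<tau>. F (S, \<tau>)) (at t within T))"

text \<open>Chain rule along the embedding of \<open>X\<close> as the slice at time
  \<open>t\<close>, which stays inside \<open>X \<times> T\<close> because
  \<open>t \<in> T\<close>.\<close>

lemma has_derivative_fst_slice: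
  assumes "(F has_derivative F') (at (S, t) within X \<times> T)" "t \<in> T"
  shows "((\<lambda>s. F (s, t)) has_vector_derivative F' (1, 0)) (at S within X)"
proof -
  have "((\<lambda>s. F (s, t)) has_derivative (\<lambda>h. F' (h, 0))) (at S within X)"
  proof -
    have "((\<lambda>s. (s, t)) has_derivative (\<lambda>h. (h, 0))) (at S within X)"
      by (auto intro!: derivative_eq_intros)
    moreover have "(F has_derivative F') (at (S, t) within (\<lambda>s. (s, t)) ` X)"
      using assms by (auto intro: has_derivative_subset)
    ultimately show ?thesis by (rule has_derivative_in_compose)
  qed
  then show ?thesis by (rule has_derivative_imp_has_vector_derivative)
qed

lemma has_derivative_snd_slice:
  assumes "(F has_derivative F') (at (S, t) within X \<times> T)" "S \<in> X"
  shows "((\<lambda>\<tau>. F (S, \<tau>)) has_vector_derivative F' (0, 1)) (at t within T)"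
proof -
  have "((\<lambda>\<tau>. F (S, \<tau>)) has_derivative (\<lambda>h. F' (0, h))) (at t within T)"
  proof -
    have "((\<lambda>\<tau>. (S, \<tau>)) has_derivative (\<lambda>h. (0, h))) (at t within T)"
      by (auto intro!: derivative_eq_intros)
    moreover have "(F has_derivative F') (at (S, t) within (\<lambda>\<tau>. (S, \<tau>)) ` T)"
      using assms by (auto intro: has_derivative_subset)
    ultimately show ?thesis by (rule has_derivative_in_compose)
  qed
  then show ?thesis by (rule has_derivative_imp_has_vector_derivative)
qed

text \<open>The derivative of the slice is again a slice, namely of the total derivative evaluated
  at \<open>(1, 0)\<close>. That map is smooth on the product to one order less, so the induction
  runs over all \<open>F\<close>.\<close>

lemma smooth_on_dom_slice:
  assumes "smooth_on_dom (X \<times> T) (F :: real \<times> real \<Rightarrow> 'b::real_normed_vector)" "t \<in> T"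
  shows "smooth_on_dom X (\<lambda>s. F (s, t))"
proof -
  have "C_k_on n X (\<lambda>s. F (s, t))" if "C_k_on n (X \<times> T) F" for n and F :: "real \<times> real \<Rightarrow> 'b"
    using that
  proof (induction n arbitrary: F)
    case 0
    then show ?case using assms(2)
      by (auto intro!: continuous_intros elim!: continuous_on_compose2)
  next
    case (Suc n)
    then obtain F' where F': "\<forall>x\<in>X \<times> T. (F has_derivative F' x) (at x within X \<times> T)"
      "\<forall>h. C_k_on n (X \<times> T) (\<lambda>x. F' x h)" by auto
    have "((\<lambda>s. F (s, t)) has_derivative (\<lambda>h. h *\<^sub>R F' (s, t) (1, 0))) (at s within X)" if "s \<in> X" for s
      using has_derivative_fst_slice[of F "F' (s, t)" s t X T] F'(1) that assms(2)
      by (auto simp: has_vector_derivative_def)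
    moreover have "C_k_on n X (\<lambda>s. h *\<^sub>R F' (s, t) (1, 0))" for h
      by (rule C_k_on_bounded_linear[OF bounded_linear_scaleR_right]) (rule Suc.IH, use F'(2) in blast)
    ultimately have "\<forall>s\<in>X. ((\<lambda>s. F (s, t)) has_derivative (\<lambda>h. h *\<^sub>R F' (s, t) (1, 0))) (at s within X)"
      "\<forall>h. C_k_on n X (\<lambda>s. h *\<^sub>R F' (s, t) (1, 0))" by blast+
    then show ?case unfolding C_k_on.simps by (intro exI conjI)
  qed
  then show ?thesis using assms(1) unfolding smooth_on_dom_def by blast
qed

text \<open>Freezing the time commutes with differentiating in space. This links the product-domain
  operators to the derivatives that occur in \<open>C_k_norm\<close>.\<close>

lemma partial_fst_iterate:
  "(partial_fst L ^^ i) F (S, t) = (deriv_seg L ^^ i) (\<lambda>s. F (s, t)) S"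
proof (induction i arbitrary: S)
  case 0
  then show ?case by simp
next
  case (Suc i)
  then have "(\<lambda>s. (partial_fst L ^^ i) F (s, t)) = (deriv_seg L ^^ i) (\<lambda>s. F (s, t))" by auto
  then have "partial_fst L ((partial_fst L ^^ i) F) (S, t) = deriv_seg L ((deriv_seg L ^^ i) (\<lambda>s. F (s, t))) S"
    by (simp add: partial_fst_def[of L "(partial_fst L ^^ i) F"])
  then show ?case by simp
qed

text \<open>Both partial derivatives are values of the total derivative in a fixed direction,
  \<open>(1, 0)\<close> or \<open>(0, 1)\<close>, and \<open>C_k_on\<close> already asserts
  regularity of these directional values. Uniqueness identifies them with \<open>partial_fst\<close>
  and \<open>partial_snd\<close>.\<close>

lemma smooth_on_dom_partials:
  assumes "0 < L" "is_interval T" "interior T \<noteq> {}" "smooth_on_dom ({0..L} \<times> T) F"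
  shows smooth_on_dom_partial_fst: "smooth_on_dom ({0..L} \<times> T) (partial_fst L F)"
    and smooth_on_dom_partial_snd: "smooth_on_dom ({0..L} \<times> T) (partial_snd T F)"
    and has_partial_fst: "\<And>S t. S \<in> {0..L} \<Longrightarrow> t \<in> T \<Longrightarrow>
      ((\<lambda>s. F (s, t)) has_vector_derivative partial_fst L F (S, t)) (at S within {0..L})"
    and has_partial_snd: "\<And>S t. S \<in> {0..L} \<Longrightarrow> t \<in> T \<Longrightarrow>
      ((\<lambda>\<tau>. F (S, \<tau>)) has_vector_derivative partial_snd T F (S, t)) (at t within T)"
proof -
  let ?D = "{0..L} \<times> T"
  have main: "C_k_on n ?D (partial_fst L F) \<and> C_k_on n ?D (partial_snd T F) \<and>
    (\<forall>S\<in>{0..L}. \<forall>t\<in>T.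
      ((\<lambda>s. F (s, t)) has_vector_derivative partial_fst L F (S, t)) (at S within {0..L}) \<and>
      ((\<lambda>\<tau>. F (S, \<tau>)) has_vector_derivative partial_snd T F (S, t)) (at t within T))" for n
  proof -
    have "C_k_on (Suc n) ?D F" using assms(4) by (simp add: smooth_on_dom_def del: C_k_on.simps)
    then obtain F' where F': "\<forall>x\<in>?D. (F has_derivative F' x) (at x within ?D)"
      "\<forall>h. C_k_on n ?D (\<lambda>x. F' x h)" by auto
    have d: "(F has_derivative F' (S, t)) (at (S, t) within ?D)" if "S \<in> {0..L}" "t \<in> T" for S t
      using F'(1) that by simp
    have d1: "((\<lambda>s. F (s, t)) has_vector_derivative F' (S, t) (1, 0)) (at S within {0..L})"
      if "S \<in> {0..L}" "t \<in> T" for S t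
      by (rule has_derivative_fst_slice[OF d[OF that] that(2)])
    have d2: "((\<lambda>\<tau>. F (S, \<tau>)) has_vector_derivative F' (S, t) (0, 1)) (at t within T)"
      if "S \<in> {0..L}" "t \<in> T" for S t
      by (rule has_derivative_snd_slice[OF d[OF that] that(1)])
    have e1: "partial_fst L F (S, t) = F' (S, t) (1, 0)" if "S \<in> {0..L}" "t \<in> T" for S t
      using deriv_seg_eq[OF assms(1) that(1) d1[OF that]] by (simp add: partial_fst_def)
    have e2: "partial_snd T F (S, t) = F' (S, t) (0, 1)" if "S \<in> {0..L}" "t \<in> T" for S t
      using vector_derivative_within[OF at_within_interval_ne_bot[OF assms(2,3) that(2)] d2[OF that]]
      by (simp add: partial_snd_def)
    have "C_k_on n ?D (partial_fst L F)"
      using F'(2) by (rule_tac C_k_on_cong[of _ "\<lambda>x. F' x (1, 0)"]) (auto simp: e1)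
    moreover have "C_k_on n ?D (partial_snd T F)"
      using F'(2) by (rule_tac C_k_on_cong[of _ "\<lambda>x. F' x (0, 1)"]) (auto simp: e2)
    ultimately show ?thesis using d1 d2 e1 e2 by simp
  qed
  show "smooth_on_dom ?D (partial_fst L F)" "smooth_on_dom ?D (partial_snd T F)"
    using main by (simp_all add: smooth_on_dom_def)
  show "((\<lambda>s. F (s, t)) has_vector_derivative partial_fst L F (S, t)) (at S within {0..L})"
    "((\<lambda>\<tau>. F (S, \<tau>)) has_vector_derivative partial_snd T F (S, t)) (at t within T)"
    if "S \<in> {0..L}" "t \<in> T" for S t
    using main[of 0] that by simp_all
qed

text \<open>
  Both sides are continuous up to the boundary, so differentiating
  \<open>F (S, \<tau>) - F (0, \<tau>) = \<integral>\<^sub>0\<^sup>S \<partial>\<^sub>S F\<close> under the integral avoids a symmetry theorem for second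
  derivatives, which would not apply directly at boundary points.
\<close>

lemma partial_commute:
  fixes F :: "real \<times> real \<Rightarrow> 'b::euclidean_space"
  assumes "0 < L" "is_interval T" "interior T \<noteq> {}" "smooth_on_dom ({0..L} \<times> T) F"
    and S: "S \<in> {0..L}" and t: "t \<in> T"
  shows "partial_fst L (partial_snd T F) (S, t) = partial_snd T (partial_fst L F) (S, t)"
proof -
  note sm = smooth_on_dom_partial_fst[OF assms(1-3)] smooth_on_dom_partial_snd[OF assms(1-3)]
  note d1 = has_partial_fst[OF assms(1-3)] and d2 = has_partial_snd[OF assms(1-3)]
  let ?g = "partial_fst L F" and ?gt = "partial_snd T (partial_fst L F)"
  have cont: "continuous_on ({0..L} \<times> T) ?g" "continuous_on ({0..L} \<times> T) ?gt"
    by (intro smooth_on_dom_continuous sm assms(4))+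
  have cont_slice: "continuous_on {0..r} (\<lambda>s. h (s, \<tau>))"
    if "continuous_on ({0..L} \<times> T) h" "r \<le> L" "\<tau> \<in> T" for h :: "real \<times> real \<Rightarrow> 'b" and \<tau> r
    by (rule continuous_on_compose2[OF that(1)]) (use that in \<open>auto intro!: continuous_intros\<close>)
  have ftc: "F (r, \<tau>) = F (0, \<tau>) + integral {0..r} (\<lambda>s. ?g (s, \<tau>))"
    if "r \<in> {0..L}" "\<tau> \<in> T" for r \<tau>
  proof -
    have "((\<lambda>s. ?g (s, \<tau>)) has_integral F (r, \<tau>) - F (0, \<tau>)) {0..r}"
    proof (rule fundamental_theorem_of_calculus)
      fix s assume "s \<in> {0..r}"
      then show "((\<lambda>s. F (s, \<tau>)) has_vector_derivative ?g (s, \<tau>)) (at s within {0..r})"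
        using that by (intro has_vector_derivative_within_subset[OF d1[OF assms(4)]]) auto
    qed (use that in auto)
    then show ?thesis by (simp add: integral_unique)
  qed
  \<comment> \<open>Both sides are time derivatives at \<open>t\<close> of the same function
    \<open>F (r, _)\<close>: once directly, once through \<open>ftc\<close> and the Leibniz
    rule.\<close>
  have eq: "partial_snd T F (r, t) = partial_snd T F (0, t) + integral {0..r} (\<lambda>s. ?gt (s, t))"
    if r: "r \<in> {0..L}" for r
  proof (rule vector_derivative_unique_within[OF at_within_interval_ne_bot[OF assms(2,3) t]])
    show "((\<lambda>\<tau>. F (r, \<tau>)) has_vector_derivative partial_snd T F (r, t)) (at t within T)"
      by (rule d2[OF assms(4) r t])
    have "((\<lambda>\<tau>. integral (cbox 0 r) (\<lambda>s. ?g (s, \<tau>))) has_vector_derivative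
      integral (cbox 0 r) (\<lambda>s. ?gt (s, t))) (at t within T)"
    proof (rule leibniz_rule_vector_derivative)
      show "((\<lambda>\<tau>. ?g (s, \<tau>)) has_vector_derivative ?gt (s, \<tau>)) (at \<tau> within T)"
        if "\<tau> \<in> T" "s \<in> cbox 0 r" for \<tau> s
        using d2[OF sm(1)[OF assms(4)]] that r by auto
      show "(\<lambda>s. ?g (s, \<tau>)) integrable_on cbox 0 r" if "\<tau> \<in> T" for \<tau>
        using integrable_continuous_real[OF cont_slice[OF cont(1) _ that, of r]] r by simp
      show "continuous_on (T \<times> cbox 0 r) (\<lambda>(\<tau>, s). ?gt (s, \<tau>))"
        unfolding split_def using r
        by (intro continuous_on_compose2[OF cont(2)]) (auto intro!: continuous_intros)
    qed (use t assms(2) in \<open>auto simp: is_interval_convex\<close>)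
    then have "((\<lambda>\<tau>. F (0, \<tau>) + integral {0..r} (\<lambda>s. ?g (s, \<tau>))) has_vector_derivative
      partial_snd T F (0, t) + integral {0..r} (\<lambda>s. ?gt (s, t))) (at t within T)"
      using has_vector_derivative_add[OF d2[OF assms(4) _ t, of 0]] assms(1) by simp
    then show "((\<lambda>\<tau>. F (r, \<tau>)) has_vector_derivative
      partial_snd T F (0, t) + integral {0..r} (\<lambda>s. ?gt (s, t))) (at t within T)"
      by (rule has_vector_derivative_transform[OF t ftc[OF r], rotated])
  qed
  \<comment> \<open>Now \<open>eq\<close> is differentiated in its upper limit at \<open>S\<close>;
    continuity of the integrand up to the boundary gives its value there.\<close>
  have "((\<lambda>r. partial_snd T F (0, t) + integral {0..r} (\<lambda>s. ?gt (s, t))) has_vector_derivative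
    0 + ?gt (S, t)) (at S within {0..L})"
    using cont_slice[OF cont(2) _ t, of L] S
    by (intro has_vector_derivative_add has_vector_derivative_const integral_has_vector_derivative) auto
  then have "((\<lambda>r. partial_snd T F (r, t)) has_vector_derivative ?gt (S, t)) (at S within {0..L})"
    using has_vector_derivative_transform[OF S eq] by simp
  then show ?thesis
    unfolding partial_fst_def[of L "partial_snd T F"] split by (rule deriv_seg_eq[OF assms(1) S])
qed

lemma smooth_on_dom_partial_fst_iterate:
  assumes "0 < L" "is_interval T" "interior T \<noteq> {}" "smooth_on_dom ({0..L} \<times> T) F"
  shows "smooth_on_dom ({0..L} \<times> T) ((partial_fst L ^^ i) F)"
  using assms by (induction i) (auto intro: smooth_on_dom_partial_fst)

text \<open>The time derivative is moved past one space derivative at a time, applying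
  \<open>partial_commute\<close> to the smooth map \<open>(partial_fst L ^^ i) F\<close>.\<close>

lemma partial_fst_iterate_commute:
  fixes F :: "real \<times> real \<Rightarrow> 'b::euclidean_space"
  assumes "0 < L" "is_interval T" "interior T \<noteq> {}" "smooth_on_dom ({0..L} \<times> T) F"
    and S: "S \<in> {0..L}" and t: "t \<in> T"
  shows "(partial_fst L ^^ i) (partial_snd T F) (S, t) = partial_snd T ((partial_fst L ^^ i) F) (S, t)"
  using S
proof (induction i arbitrary: S)
  case 0
  then show ?case by simp
next
  case (Suc i)
  have "(partial_fst L ^^ Suc i) (partial_snd T F) (S, t) =
        partial_fst L (partial_snd T ((partial_fst L ^^ i) F)) (S, t)"
    using Suc
    by (auto simp: partial_fst_def[of L "partial_snd _ _"] partial_fst_def[of L "(_ ^^ i) _"]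
        intro!: deriv_seg_cong)
  also have "\<dots> = partial_snd T ((partial_fst L ^^ Suc i) F) (S, t)"
    using partial_commute[OF assms(1-3) smooth_on_dom_partial_fst_iterate[OF assms(1-4)] Suc.prems t]
    by simp
  finally show ?case .
qed

section \<open>First-order time expansion, uniform along the segment\<close>

text \<open>Compactness of \<open>{0..L}\<close> yields one time neighbourhood on which the time
  derivative stays within \<open>e\<close> of its value at \<open>t\<close> for all \<open>S\<close>
  at once. The mean value inequality turns this into a bound on the linearization error.\<close>

lemma partial_snd_uniform:
  assumes "0 < L" "is_interval T" "interior T \<noteq> {}" "smooth_on_dom ({0..L} \<times> T) F" "t \<in> T" "0 < e"
  obtains d where "0 < d" "\<And>S \<tau>. S \<in> {0..L} \<Longrightarrow> \<tau> \<in> T \<Longrightarrow> \<bar>\<tau> - t\<bar> < d \<Longrightarrow>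
    norm (F (S, \<tau>) - F (S, t) - (\<tau> - t) *\<^sub>R partial_snd T F (S, t)) \<le> e * \<bar>\<tau> - t\<bar>"
proof -
  let ?g = "partial_snd T F"
  have "continuous_on ({0..L} \<times> T) ?g"
    by (intro smooth_on_dom_continuous smooth_on_dom_partial_snd assms)
  \<comment> \<open>The variables are swapped because the compactness argument takes the compact
    factor second.\<close>
  then have cont: "continuous_on (T \<times> {0..L}) (\<lambda>(\<tau>, S). ?g (S, \<tau>))"
    unfolding split_def by (rule continuous_on_compose2) (auto intro!: continuous_intros)
  obtain X where X: "t \<in> X" "open X"
    "\<forall>\<tau>\<in>X \<inter> T. \<forall>S\<in>{0..L}. dist (?g (S, \<tau>)) (?g (S, t)) \<le> e"
    using continuous_on_prod_compactE[OF cont compact_Icc assms(5,6)] by auto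
  then obtain d where d: "0 < d" "ball t d \<subseteq> X" by (meson openE)
  show thesis
  proof (rule that[OF d(1)])
    fix S \<tau> assume S: "S \<in> {0..L}" and \<tau>: "\<tau> \<in> T" "\<bar>\<tau> - t\<bar> < d"
    \<comment> \<open>Convexity keeps the segment from \<open>t\<close> to \<open>\<tau>\<close>
      inside the neighbourhood, as the mean value inequality requires.\<close>
    have conv: "convex (T \<inter> ball t d)"
      using assms(2) by (auto intro: convex_Int simp: is_interval_convex)
    have "norm (F (S, \<tau>) - F (S, t) - (\<tau> - t) *\<^sub>R ?g (S, t)) \<le> norm (\<tau> - t) * e"
    proof (rule vector_differentiable_bound_linearization[where S="T \<inter> ball t d"])
      show "((\<lambda>\<tau>. F (S, \<tau>)) has_vector_derivative ?g (S, r)) (at r within T \<inter> ball t d)"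
        if "r \<in> T \<inter> ball t d" for r
        using has_partial_snd[OF assms(1-4) S] that
        by (auto intro: has_vector_derivative_within_subset)
      show "closed_segment t \<tau> \<subseteq> T \<inter> ball t d"
        using \<tau> assms(5) d(1) by (intro closed_segment_subset conv) (auto simp: dist_real_def)
      show "norm (?g (S, r) - ?g (S, t)) \<le> e" if "r \<in> T \<inter> ball t d" for r
        using X(3) d(2) that S by (auto simp: dist_norm)
      show "t \<in> T \<inter> ball t d" using assms(5) d(1) by simp
    qed
    then show "norm (F (S, \<tau>) - F (S, t) - (\<tau> - t) *\<^sub>R ?g (S, t)) \<le> e * \<bar>\<tau> - t\<bar>"
      by (simp add: mult.commute)
  qed
qed

section \<open>Increments of a field in the \<open>C_k_norm\<close>\<close>

lemma field_of_smooth_fields: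
  assumes "smooth_on_dom {0..L} u"
  shows "field_of L u \<in> smooth_fields L"
  using smooth_on_dom_cong[OF _ assms, of "field_of L u"]
  by (simp add: smooth_fields_def field_of_def)

lemma field_of_cong: "(\<And>S. S \<in> {0..L} \<Longrightarrow> u S = w S) \<Longrightarrow> field_of L u = field_of L w"
  unfolding field_of_def by (rule restrict_ext)

lemma C_k_norm_field_of:
  assumes "0 \<le> L" "\<And>i S. i \<le> k \<Longrightarrow> S \<in> {0..L} \<Longrightarrow> norm ((deriv_seg L ^^ i) h S) \<le> c"
  shows "0 \<le> C_k_norm k L (field_of L h)" "C_k_norm k L (field_of L h) \<le> real (Suc k) * c"
proof -
  have "(deriv_seg L ^^ i) (field_of L h) S = (deriv_seg L ^^ i) h S" if "S \<in> {0..L}" for i S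
    using that by (intro deriv_seg_iterate_cong) (auto simp: field_of_def)
  with assms(2) have "norm ((deriv_seg L ^^ i) (field_of L h) S) \<le> c" if "i \<le> k" "S \<in> {0..L}" for i S
    using that by metis
  then show "0 \<le> C_k_norm k L (field_of L h)" "C_k_norm k L (field_of L h) \<le> real (Suc k) * c"
    using C_k_norm_bounds[OF assms(1), of k "field_of L h" c] by blast+
qed

text \<open>Since the partial derivatives commute, differentiating the remainder of \<open>F\<close>
  in space gives the remainder of the differentiated map. The order-zero estimate applied to
  \<open>(partial_fst L ^^ i) F\<close> therefore covers order \<open>i\<close>.\<close>

lemma deriv_seg_iterate_remainder:
  fixes F :: "real \<times> real \<Rightarrow> 'b::euclidean_space"
  assumes "0 < L" "is_interval T" "interior T \<noteq> {}" "smooth_on_dom ({0..L} \<times> T) F" "t \<in> T"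
    and "S \<in> {0..L}" "\<tau> \<in> T"
  shows "(deriv_seg L ^^ i) (\<lambda>s. F (s, \<tau>) - F (s, t) - c *\<^sub>R partial_snd T F (s, t)) S =
      (partial_fst L ^^ i) F (S, \<tau>) - (partial_fst L ^^ i) F (S, t) -
      c *\<^sub>R partial_snd T ((partial_fst L ^^ i) F) (S, t)"
proof -
  note sl = smooth_on_dom_slice[OF assms(4)]
    smooth_on_dom_slice[OF smooth_on_dom_partial_snd[OF assms(1-4)]]
  note lin = deriv_seg_iterate_lincomb[OF assms(1) _ _ assms(6)]
  \<comment> \<open>The differences are rewritten as nested linear combinations of two terms, the
    form of \<open>deriv_seg_iterate_lincomb\<close>.\<close>
  have "(deriv_seg L ^^ i) (\<lambda>s. F (s, \<tau>) - F (s, t) - c *\<^sub>R partial_snd T F (s, t)) S =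
    (deriv_seg L ^^ i) (\<lambda>s. 1 *\<^sub>R (1 *\<^sub>R F (s, \<tau>) + (-1) *\<^sub>R F (s, t))
      + (- c) *\<^sub>R partial_snd T F (s, t)) S" by simp
  also have "\<dots> = 1 *\<^sub>R (deriv_seg L ^^ i) (\<lambda>s. 1 *\<^sub>R F (s, \<tau>) + (-1) *\<^sub>R F (s, t)) S +
    (- c) *\<^sub>R (deriv_seg L ^^ i) (\<lambda>s. partial_snd T F (s, t)) S"
    by (rule lin) (intro smooth_on_dom_lincomb sl assms)+
  also have "(deriv_seg L ^^ i) (\<lambda>s. 1 *\<^sub>R F (s, \<tau>) + (-1) *\<^sub>R F (s, t)) S =
    1 *\<^sub>R (deriv_seg L ^^ i) (\<lambda>s. F (s, \<tau>)) S + (-1) *\<^sub>R (deriv_seg L ^^ i) (\<lambda>s. F (s, t)) S"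
    by (rule lin) (intro sl assms)+
  finally show ?thesis
    using partial_fst_iterate_commute[OF assms(1-4,6,5), of i] by (simp add: partial_fst_iterate)
qed

text \<open>Each order has its own neighbourhood of \<open>t\<close>; only finitely many orders
  \<open>i \<le> k\<close> occur, so they hold jointly.\<close>

lemma deriv_seg_iterate_remainder_uniform:
  fixes F :: "real \<times> real \<Rightarrow> 'b::euclidean_space"
  assumes "0 < L" "is_interval T" "interior T \<noteq> {}" "smooth_on_dom ({0..L} \<times> T) F" "t \<in> T" "0 < e"
  shows "\<forall>\<^sub>F \<tau> in at t within T. \<forall>i\<le>k. \<forall>S\<in>{0..L}.
    norm ((deriv_seg L ^^ i) (\<lambda>s. F (s, \<tau>) - F (s, t) - (\<tau> - t) *\<^sub>R partial_snd T F (s, t)) S)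
      \<le> e * \<bar>\<tau> - t\<bar>"
proof -
  have "\<forall>\<^sub>F \<tau> in at t within T. \<forall>S\<in>{0..L}.
    norm ((deriv_seg L ^^ i) (\<lambda>s. F (s, \<tau>) - F (s, t) - (\<tau> - t) *\<^sub>R partial_snd T F (s, t)) S)
      \<le> e * \<bar>\<tau> - t\<bar>" for i
  proof -
    let ?G = "(partial_fst L ^^ i) F"
    obtain d where d: "0 < d" "\<And>S \<tau>. S \<in> {0..L} \<Longrightarrow> \<tau> \<in> T \<Longrightarrow> \<bar>\<tau> - t\<bar> < d \<Longrightarrow>
      norm (?G (S, \<tau>) - ?G (S, t) - (\<tau> - t) *\<^sub>R partial_snd T ?G (S, t)) \<le> e * \<bar>\<tau> - t\<bar>"
      using partial_snd_uniform[OF assms(1-3) smooth_on_dom_partial_fst_iterate[OF assms(1-4)]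
          assms(5,6)] by blast
    show ?thesis
      unfolding eventually_at using d deriv_seg_iterate_remainder[OF assms(1-5)]
      by (intro exI[of _ d]) (auto simp: dist_real_def)
  qed
  then have "\<forall>\<^sub>F \<tau> in at t within T. \<forall>i\<in>{..k}. \<forall>S\<in>{0..L}.
    norm ((deriv_seg L ^^ i) (\<lambda>s. F (s, \<tau>) - F (s, t) - (\<tau> - t) *\<^sub>R partial_snd T F (s, t)) S)
      \<le> e * \<bar>\<tau> - t\<bar>"
    by (simp add: eventually_ball_finite)
  then show ?thesis by (simp only: Ball_def atMost_iff)
qed

lemma C_k_norm_remainder:
  fixes F :: "real \<times> real \<Rightarrow> real^3"
  assumes "0 < L" "is_interval T" "interior T \<noteq> {}" "smooth_on_dom ({0..L} \<times> T) F" "t \<in> T" "0 < e"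
  shows "\<forall>\<^sub>F \<tau> in at t within T.
    0 \<le> C_k_norm k L (field_of L (\<lambda>s. F (s, \<tau>) - F (s, t) - (\<tau> - t) *\<^sub>R partial_snd T F (s, t))) \<and>
    C_k_norm k L (field_of L (\<lambda>s. F (s, \<tau>) - F (s, t) - (\<tau> - t) *\<^sub>R partial_snd T F (s, t)))
      \<le> e * \<bar>\<tau> - t\<bar>"
proof -
  \<comment> \<open>The norm sums \<open>Suc k\<close> suprema, so each order receives this share of
    \<open>e\<close>.\<close>
  have "0 < e / real (Suc k)" using assms(6) by simp
  from deriv_seg_iterate_remainder_uniform[OF assms(1-5) this, of k] show ?thesis
  proof eventually_elim
    case (elim \<tau>)
    then have "norm ((deriv_seg L ^^ i)
        (\<lambda>s. F (s, \<tau>) - F (s, t) - (\<tau> - t) *\<^sub>R partial_snd T F (s, t)) S)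
        \<le> e / real (Suc k) * \<bar>\<tau> - t\<bar>" if "i \<le> k" "S \<in> {0..L}" for i S
      using that by blast
    from C_k_norm_field_of[OF less_imp_le[OF assms(1)] this, of k] show ?case by simp
  qed
qed

text \<open>The increment is the remainder plus \<open>\<tau> - t\<close> times the time derivative.
  The former is small and the latter has bounded space derivatives on the compact segment, so the
  increment is Lipschitz in time at \<open>t\<close>.\<close>

lemma C_k_norm_increment:
  fixes F :: "real \<times> real \<Rightarrow> real^3"
  assumes "0 < L" "is_interval T" "interior T \<noteq> {}" "smooth_on_dom ({0..L} \<times> T) F" "t \<in> T"
  obtains M where "0 < M" "\<forall>\<^sub>F \<tau> in at t within T.
    C_k_norm k L (field_of L (\<lambda>s. F (s, \<tau>) - F (s, t))) \<le> M * \<bar>\<tau> - t\<bar>"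
proof -
  let ?\<eta> = "\<lambda>s. partial_snd T F (s, t)"
  have \<eta>: "smooth_on_dom {0..L} ?\<eta>"
    by (rule smooth_on_dom_slice[OF smooth_on_dom_partial_snd[OF assms(1-4)] assms(5)])
  have "\<exists>m. \<forall>S\<in>{0..L}. norm ((deriv_seg L ^^ i) ?\<eta> S) \<le> m" for i
  proof -
    have "continuous_on {0..L} ((deriv_seg L ^^ i) ?\<eta>)"
      by (intro smooth_on_dom_continuous smooth_on_dom_deriv_seg_iterate \<eta> assms)
    then have "bounded ((deriv_seg L ^^ i) ?\<eta> ` {0..L})"
      by (intro compact_imp_bounded compact_continuous_image) auto
    then show ?thesis by (auto simp: bounded_iff)
  qed
  then obtain m where m: "\<And>i S. S \<in> {0..L} \<Longrightarrow> norm ((deriv_seg L ^^ i) ?\<eta> S) \<le> m i" by metis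
  \<comment> \<open>The \<open>1\<close> pays for the remainder, estimated below with
    \<open>e = 1\<close>; the sum dominates every \<open>m i\<close> with
    \<open>i \<le> k\<close>.\<close>
  define M where "M = 1 + (\<Sum>i\<le>k. \<bar>m i\<bar>)"
  have "1 \<le> M" by (simp add: M_def sum_nonneg)
  have mM: "1 + m i \<le> M" if "i \<le> k" for i
    using member_le_sum[of i "{..k}" "\<lambda>i. \<bar>m i\<bar>"] that by (simp add: M_def)
  have "\<forall>\<^sub>F \<tau> in at t within T. \<tau> \<in> T" by (simp add: eventually_at_filter)
  with deriv_seg_iterate_remainder_uniform[OF assms zero_less_one, of k]
  have "\<forall>\<^sub>F \<tau> in at t within T.
    C_k_norm k L (field_of L (\<lambda>s. F (s, \<tau>) - F (s, t))) \<le> (real (Suc k) * M) * \<bar>\<tau> - t\<bar>"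
  proof eventually_elim
    case (elim \<tau>)
    let ?r = "\<lambda>s. F (s, \<tau>) - F (s, t) - (\<tau> - t) *\<^sub>R ?\<eta> s"
    have r: "smooth_on_dom {0..L} ?r"
      by (intro smooth_on_dom_diff smooth_on_dom_bounded_linear[OF bounded_linear_scaleR_right]
          smooth_on_dom_slice[OF assms(4)] \<eta> elim(2) assms(5))
    have "norm ((deriv_seg L ^^ i) (\<lambda>s. F (s, \<tau>) - F (s, t)) S) \<le> M * \<bar>\<tau> - t\<bar>"
      if "i \<le> k" "S \<in> {0..L}" for i S
    proof -
      have "(deriv_seg L ^^ i) (\<lambda>s. F (s, \<tau>) - F (s, t)) S =
        (deriv_seg L ^^ i) ?r S + (\<tau> - t) *\<^sub>R (deriv_seg L ^^ i) ?\<eta> S"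
        using deriv_seg_iterate_lincomb[OF assms(1) r \<eta> that(2), of i 1 "\<tau> - t"] by simp
      also have "norm \<dots> \<le> 1 * \<bar>\<tau> - t\<bar> + \<bar>\<tau> - t\<bar> * m i"
        using elim(1) m[OF that(2), of i] that
        by (intro norm_triangle_mono) (auto simp: mult_left_mono)
      also have "\<dots> = (1 + m i) * \<bar>\<tau> - t\<bar>" by (simp add: algebra_simps)
      also have "\<dots> \<le> M * \<bar>\<tau> - t\<bar>" using mM[OF that(1)] by (intro mult_right_mono) auto
      finally show ?thesis .
    qed
    from C_k_norm_field_of(2)[OF less_imp_le[OF assms(1)] this, of k] show ?case by (simp add: mult.assoc)
  qed
  moreover have "0 < real (Suc k) * M" using \<open>1 \<le> M\<close> by simp
  ultimately show thesis by (rule that[rotated])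
qed

section \<open>Chain rule for functionals of a time-dependent field\<close>

text \<open>The error of the expansion of \<open>f\<close> is small relative to the norm of the
  increment, which is of order \<open>\<tau> - t\<close>. By linearity \<open>df\<close> of the
  increment is \<open>\<tau> - t\<close> times \<open>df\<close> of the time derivative plus
  \<open>df\<close> of the remainder, and the bound on \<open>df\<close> makes the last term
  negligible.\<close>

lemma has_real_derivative_functional:
  fixes F :: "real \<times> real \<Rightarrow> real^3"
  assumes "0 < L" "is_interval T" "interior T \<noteq> {}" "smooth_on_dom ({0..L} \<times> T) F" "t \<in> T"
    and df: "has_differential k L f (field_of L (\<lambda>s. F (s, t))) df"
  shows "((\<lambda>\<tau>. f (field_of L (\<lambda>s. F (s, \<tau>)))) has_real_derivative
    df (field_of L (\<lambda>s. partial_snd T F (s, t)))) (at t within T)"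
proof -
  let ?\<eta> = "\<lambda>s. partial_snd T F (s, t)"
  let ?h = "\<lambda>\<tau>. field_of L (\<lambda>s. F (s, \<tau>) - F (s, t))"
  let ?r = "\<lambda>\<tau>. field_of L (\<lambda>s. F (s, \<tau>) - F (s, t) - (\<tau> - t) *\<^sub>R ?\<eta> s)"
  let ?f = "\<lambda>\<tau>. f (field_of L (\<lambda>s. F (s, \<tau>)))"
  have lin: "\<And>h1 h2 a b. h1 \<in> smooth_fields L \<Longrightarrow> h2 \<in> smooth_fields L \<Longrightarrow>
      df (field_of L (\<lambda>S. a *\<^sub>R h1 S + b *\<^sub>R h2 S)) = a * df h1 + b * df h2"
    using df by (simp add: has_differential_def)
  obtain B where B: "\<And>h. h \<in> smooth_fields L \<Longrightarrow> \<bar>df h\<bar> \<le> B * C_k_norm k L h"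
    using df unfolding has_differential_def by blast
  have small: "\<exists>d>0. \<forall>h\<in>smooth_fields L. C_k_norm k L h < d \<longrightarrow>
      \<bar>f (field_of L (\<lambda>S. field_of L (\<lambda>s. F (s, t)) S + h S)) - f (field_of L (\<lambda>s. F (s, t))) - df h\<bar>
        \<le> e * C_k_norm k L h" if "0 < e" for e
    using df that by (simp add: has_differential_def)
  note sl = smooth_on_dom_slice[OF assms(4)]
  have \<eta>: "smooth_on_dom {0..L} ?\<eta>"
    by (rule smooth_on_dom_slice[OF smooth_on_dom_partial_snd[OF assms(1-4)] assms(5)])
  have h_in: "?h \<tau> \<in> smooth_fields L" if "\<tau> \<in> T" for \<tau>
    using sl that assms(5) by (intro field_of_smooth_fields smooth_on_dom_diff)
  have r_in: "?r \<tau> \<in> smooth_fields L" if "\<tau> \<in> T" for \<tau>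
    using sl that assms(5) \<eta>
    by (intro field_of_smooth_fields smooth_on_dom_diff
        smooth_on_dom_bounded_linear[OF bounded_linear_scaleR_right])
  have split: "df (?h \<tau>) = (\<tau> - t) * df (field_of L ?\<eta>) + df (?r \<tau>)" if "\<tau> \<in> T" for \<tau>
  proof -
    have "?h \<tau> = field_of L (\<lambda>S. (\<tau> - t) *\<^sub>R field_of L ?\<eta> S + 1 *\<^sub>R ?r \<tau> S)"
      by (rule field_of_cong) (simp add: field_of_def)
    then show ?thesis
      using lin[OF field_of_smooth_fields[OF \<eta>] r_in[OF that], of "\<tau> - t" 1] by simp
  qed
  \<comment> \<open>In \<open>has_differential\<close> the variation is added to the extensional
    base field and the sum is restricted again; this yields exactly the field at time
    \<open>\<tau>\<close>.\<close>
  have shift: "field_of L (\<lambda>S. field_of L (\<lambda>s. F (s, t)) S + ?h \<tau> S) = field_of L (\<lambda>s. F (s, \<tau>))" for \<tau>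
    by (rule field_of_cong) (simp add: field_of_def)
  obtain M where M: "0 < M" "\<forall>\<^sub>F \<tau> in at t within T. C_k_norm k L (?h \<tau>) \<le> M * \<bar>\<tau> - t\<bar>"
    by (rule C_k_norm_increment[OF assms(1-5)])
  have "\<forall>\<^sub>F \<tau> in at t within T. \<bar>?f \<tau> - ?f t - (\<tau> - t) * df (field_of L ?\<eta>)\<bar> \<le> e * \<bar>\<tau> - t\<bar>"
    if e: "0 < e" for e
  proof -
    \<comment> \<open>Each of the two errors may use half of \<open>e\<close>: \<open>M\<close>
      cancels the Lipschitz constant of the increment, and \<open>\<bar>B\<bar> + 1\<close> is a
      strictly positive bound for \<open>df\<close>, whatever the sign of \<open>B\<close>.\<close>
    let ?e1 = "e / (2 * M)" and ?e2 = "e / (2 * (\<bar>B\<bar> + 1))"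
    have pos: "0 < ?e1" "0 < ?e2" using e M(1) by auto
    obtain d where d: "0 < d" "\<And>h. h \<in> smooth_fields L \<Longrightarrow> C_k_norm k L h < d \<Longrightarrow>
      \<bar>f (field_of L (\<lambda>S. field_of L (\<lambda>s. F (s, t)) S + h S)) - f (field_of L (\<lambda>s. F (s, t))) - df h\<bar>
        \<le> ?e1 * C_k_norm k L h"
      using small[OF pos(1)] by blast
    have "\<forall>\<^sub>F \<tau> in at t within T. \<tau> \<in> T" by (simp add: eventually_at_filter)
    \<comment> \<open>Together with the Lipschitz bound, this brings the norm of the increment below
      \<open>d\<close>.\<close>
    moreover have "\<forall>\<^sub>F \<tau> in at t within T. \<bar>\<tau> - t\<bar> < d / M"
      unfolding eventually_at using d(1) M(1)
      by (intro exI[of _ "d / M"]) (auto simp: dist_real_def)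
    moreover note M(2) C_k_norm_remainder[OF assms(1-5) pos(2), of k]
    ultimately show ?thesis
    proof eventually_elim
      case (elim \<tau>)
      have "M * \<bar>\<tau> - t\<bar> < d" using elim(2) M(1) by (simp add: field_simps)
      then have "\<bar>?f \<tau> - ?f t - df (?h \<tau>)\<bar> \<le> ?e1 * C_k_norm k L (?h \<tau>)"
        using d(2)[OF h_in[OF elim(1)]] elim(3) by (simp add: shift)
      also have "\<dots> \<le> ?e1 * (M * \<bar>\<tau> - t\<bar>)" using elim(3) pos by (intro mult_left_mono) auto
      also have "\<dots> = e / 2 * \<bar>\<tau> - t\<bar>" using M(1) by simp
      finally have 1: "\<bar>?f \<tau> - ?f t - df (?h \<tau>)\<bar> \<le> e / 2 * \<bar>\<tau> - t\<bar>" .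
      have "\<bar>df (?r \<tau>)\<bar> \<le> B * C_k_norm k L (?r \<tau>)" by (rule B[OF r_in[OF elim(1)]])
      also have "\<dots> \<le> (\<bar>B\<bar> + 1) * C_k_norm k L (?r \<tau>)" using elim(4) by (intro mult_right_mono) auto
      also have "\<dots> \<le> (\<bar>B\<bar> + 1) * (?e2 * \<bar>\<tau> - t\<bar>)" using elim(4) by (intro mult_left_mono) auto
      also have "\<dots> = e / 2 * \<bar>\<tau> - t\<bar>" by (simp add: field_simps)
      finally have 2: "\<bar>df (?r \<tau>)\<bar> \<le> e / 2 * \<bar>\<tau> - t\<bar>" .
      have "\<bar>?f \<tau> - ?f t - (\<tau> - t) * df (field_of L ?\<eta>)\<bar> =
        \<bar>(?f \<tau> - ?f t - df (?h \<tau>)) + df (?r \<tau>)\<bar>" unfolding split[OF elim(1)] by simp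
      then show ?case using 1 2 by linarith
    qed
  qed
  then show ?thesis
    unfolding has_field_derivative_def has_derivative_within_alt2
    by (auto simp: bounded_linear_mult_right mult.commute)
qed

text \<open>The gradient represents \<open>df\<close> as an integral against \<open>g\<close>. Only
  values on the segment enter, so the restricted time derivative may be replaced by
  \<open>w\<close>; integrability is part of the representation.\<close>

lemma has_real_derivative_gradient:
  fixes F :: "real \<times> real \<Rightarrow> real^3"
  assumes "0 < L" "is_interval T" "interior T \<noteq> {}" "smooth_on_dom ({0..L} \<times> T) F" "t \<in> T"
    and g: "has_gradient k L f (field_of L (\<lambda>s. F (s, t))) g"
    and w: "\<And>S. S \<in> {0..L} \<Longrightarrow> partial_snd T F (S, t) = w S"
  shows "(\<lambda>S. g S \<bullet> w S) integrable_on {0..L} \<and>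
    ((\<lambda>\<tau>. f (field_of L (\<lambda>s. F (s, \<tau>)))) has_real_derivative
      integral {0..L} (\<lambda>S. g S \<bullet> w S)) (at t within T)"
proof -
  obtain df where df: "has_differential k L f (field_of L (\<lambda>s. F (s, t))) df"
    "\<And>h. h \<in> smooth_fields L \<Longrightarrow> ((\<lambda>S. g S \<bullet> h S) has_integral df h) {0..L}"
    using g by (auto simp: has_gradient_def)
  let ?\<eta> = "field_of L (\<lambda>s. partial_snd T F (s, t))"
  have "?\<eta> \<in> smooth_fields L"
    by (rule field_of_smooth_fields[OF smooth_on_dom_slice[OF smooth_on_dom_partial_snd[OF assms(1-4)] assms(5)]])
  then have "((\<lambda>S. g S \<bullet> ?\<eta> S) has_integral df ?\<eta>) {0..L}" by (rule df(2))
  then have "((\<lambda>S. g S \<bullet> w S) has_integral df ?\<eta>) {0..L}"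
    by (rule has_integral_eq[rotated]) (simp add: field_of_def w)
  then show ?thesis
    using has_real_derivative_functional[OF assms(1-5) df(1)]
    by (auto simp: has_integral_iff)
qed

section \<open>Rotating frames and the evolution of the strain\<close>

lemma matrix_vector_frame_comps:
  assumes "rotation_matrix Q"
  shows "Q *v frame_comps Q u = u"
proof -
  have "Q ** matrix_inv Q = mat 1"
    \<comment> \<open>\<open>matrix_inv\<close> is a choice among two-sided inverses; the transpose
      witnesses that one exists.\<close>
    unfolding matrix_inv_def
    by (rule someI2[of _ "transpose Q"]) (use assms in \<open>auto simp: orthogonal_matrix_def rotation_matrix_def\<close>)
  then show ?thesis by (simp add: frame_comps_def matrix_vector_mul_assoc)
qed

text \<open>Rotations preserve the cross product, and \<open>Q\<close> carries the moving components
  of \<open>w\<close> back to \<open>w\<close>. This turns the matrix equation for the frame into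
  the angular velocity law for a director.\<close>

lemma rotation_j_inv_director:
  assumes "rotation_matrix Q"
  shows "(Q ** j_inv (frame_comps Q w)) *v axis i 1 = cross3 w (director Q i)"
  by (simp add: director_def matrix_vector_mul_assoc[symmetric] j_inv_mult
      cross_rotation_matrix[OF assms, symmetric] matrix_vector_frame_comps[OF assms])

lemma bounded_linear_matrix_column: "bounded_linear (\<lambda>M :: real^'n^'m. M *v x)"
  by (intro linear_linear[THEN iffD2] linearI)
    (simp_all add: matrix_vector_mult_add_rdistrib scaleR_matrix_vector_assoc)

theorem proposition4p5:
  fixes L E G A \<rho> I1 I2 I3 :: real
    and T :: "real set"
    and \<phi> p \<sigma> v \<omega> \<epsilon> \<kappa> :: "real \<Rightarrow> real \<Rightarrow> real^3"
    and R :: "real \<Rightarrow> real \<Rightarrow> real^3^3"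
    and f :: "(real \<Rightarrow> real^3) \<Rightarrow> real"
    and grad :: "(real \<Rightarrow> real^3) \<Rightarrow> (real \<Rightarrow> real^3)"
    and k :: nat
  assumes "L > 0"
    and "E > 0" "G > 0" "A > 0" "\<rho> > 0" "I1 > 0" "I2 > 0" "I3 > 0"
    and "is_interval T" "interior T \<noteq> {}"
    and "smooth_on_dom ({0..L} \<times> T) (\<lambda>(S, t). \<phi> S t)"
    and "smooth_on_dom ({0..L} \<times> T) (\<lambda>(S, t). p S t)"
    and "smooth_on_dom ({0..L} \<times> T) (\<lambda>(S, t). R S t)"
    and "smooth_on_dom ({0..L} \<times> T) (\<lambda>(S, t). \<sigma> S t)"
    and "\<And>S t. S \<in> {0..L} \<Longrightarrow> t \<in> T \<Longrightarrow> rotation_matrix (R S t)"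
    and "\<And>S t. \<epsilon> S t = strain L \<phi> R S t"
    and "\<And>S t. \<kappa> S t = curvature L R S t"
    and "\<And>S t. v S t = in_frame (R S t) (matrix_inv (A_tensor \<rho> A)) (p S t)"
    and "\<And>S t. \<omega> S t = in_frame (R S t) (matrix_inv (J_tensor \<rho> I1 I2 I3)) (\<sigma> S t)"
    and "\<And>S t. S \<in> {0..L} \<Longrightarrow> t \<in> T \<Longrightarrow>
          ((\<lambda>\<tau>. \<phi> S \<tau>) has_vector_derivative
             in_frame (R S t) (matrix_inv (A_tensor \<rho> A)) (p S t)) (at t within T)"
    and "\<And>S t. S \<in> {0..L} \<Longrightarrow> t \<in> T \<Longrightarrow>
          ((\<lambda>\<tau>. p S \<tau>) has_vector_derivative
             partial_S L (\<lambda>s \<tau>. in_frame (R s \<tau>) (G_tensor E G A) (\<epsilon> s \<tau>)) S t) (at t within T)"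
    and "\<And>S t. S \<in> {0..L} \<Longrightarrow> t \<in> T \<Longrightarrow>
          ((\<lambda>\<tau>. R S \<tau>) has_vector_derivative
             R S t ** j_inv (frame_comps (R S t)
               (in_frame (R S t) (matrix_inv (J_tensor \<rho> I1 I2 I3)) (\<sigma> S t)))) (at t within T)"
    and "\<And>S t. S \<in> {0..L} \<Longrightarrow> t \<in> T \<Longrightarrow>
          ((\<lambda>\<tau>. \<sigma> S \<tau>) has_vector_derivative
             partial_S L (\<lambda>s \<tau>. in_frame (R s \<tau>) (H_tensor E G I1 I2 I3) (\<kappa> s \<tau>)) S t
             + cross3 (partial_S L \<phi> S t) (in_frame (R S t) (G_tensor E G A) (\<epsilon> S t)))
          (at t within T)"
    and "test_function k L f grad"
    and "t \<in> T"
  shows "(\<lambda>S. grad (field_of L (\<lambda>s. \<epsilon> s t)) S \<bullet>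
            (partial_S L v S t - cross3 (\<omega> S t) (director (R S t) 3))) integrable_on {0..L} \<and>
         ((\<lambda>\<tau>. f (field_of L (\<lambda>s. \<epsilon> s \<tau>))) has_real_derivative
            integral {0..L} (\<lambda>S. grad (field_of L (\<lambda>s. \<epsilon> s t)) S \<bullet>
              (partial_S L v S t - cross3 (\<omega> S t) (director (R S t) 3)))) (at t within T)"
proof -
  note dom = assms(1,9,10)
  let ?D = "{0..L} \<times> T"
  \<comment> \<open>The strain as a single map on \<open>?D\<close>, with the third director written
    as a linear image of \<open>R\<close>; smoothness of \<open>\<phi>\<close> and \<open>R\<close>
    then carries over.\<close>
  let ?F = "\<lambda>x. partial_fst L (\<lambda>(S, t). \<phi> S t) x - (case x of (S, t) \<Rightarrow> R S t) *v axis 3 1"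
  have F: "?F (S, \<tau>) = \<epsilon> S \<tau>" for S \<tau>
    by (simp add: assms(16) strain_def director_def partial_fst_def)
  note sm_\<phi>S = smooth_on_dom_partial_fst[OF dom assms(11)]
  have smF: "smooth_on_dom ?D ?F"
    by (intro smooth_on_dom_diff sm_\<phi>S
        smooth_on_dom_bounded_linear[OF bounded_linear_matrix_column] assms(13))
  have dF: "partial_snd T ?F (S, t) = partial_S L v S t - cross3 (\<omega> S t) (director (R S t) 3)"
    if S: "S \<in> {0..L}" for S
  proof -
    note ne = at_within_interval_ne_bot[OF dom(2,3) \<open>t \<in> T\<close>]
    \<comment> \<open>The equation for \<open>\<phi>\<close> is needed on the whole segment rather
      than only at \<open>S\<close>, because it is differentiated in space next.\<close>
    have "partial_snd T (\<lambda>(S, t). \<phi> S t) (s, t) = v s t" if "s \<in> {0..L}" for s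
      using vector_derivative_within[OF ne assms(20)[OF that \<open>t \<in> T\<close>]]
      by (simp add: partial_snd_def assms(18))
    then have "partial_snd T (partial_fst L (\<lambda>(S, t). \<phi> S t)) (S, t) = partial_S L v S t"
      unfolding partial_commute[OF dom assms(11) S \<open>t \<in> T\<close>, symmetric]
        partial_fst_def[of L "partial_snd T _"] split
      by (rule deriv_seg_cong[OF _ S])
    then have 1: "((\<lambda>\<tau>. partial_fst L (\<lambda>(S, t). \<phi> S t) (S, \<tau>)) has_vector_derivative
        partial_S L v S t) (at t within T)"
      using has_partial_snd[OF dom sm_\<phi>S S \<open>t \<in> T\<close>] by simp
    \<comment> \<open>The equation for \<open>R\<close>, applied to the constant vector
      \<open>axis 3 1\<close>, gives the velocity of the third director.\<close>
    have 2: "((\<lambda>\<tau>. R S \<tau> *v axis 3 1) has_vector_derivative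
        cross3 (\<omega> S t) (director (R S t) 3)) (at t within T)"
      using bounded_linear.has_vector_derivative[OF bounded_linear_matrix_column assms(22)[OF S \<open>t \<in> T\<close>]]
      unfolding rotation_j_inv_director[OF assms(15)[OF S \<open>t \<in> T\<close>], symmetric] assms(19) .
    show ?thesis
      using vector_derivative_within[OF ne has_vector_derivative_diff[OF 1 2]]
      by (simp add: partial_snd_def)
  qed
  have grad: "has_gradient k L f (field_of L (\<lambda>s. ?F (s, t))) (grad (field_of L (\<lambda>s. ?F (s, t))))"
    using assms(24) field_of_smooth_fields[OF smooth_on_dom_slice[OF smF \<open>t \<in> T\<close>]]
    by (simp add: test_function_def)
  show ?thesis
    using has_real_derivative_gradient[OF dom smF \<open>t \<in> T\<close> grad dF] unfolding F .
qed

end
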